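(* Let $\boldsymbol{\theta}=(\theta_{1},\dots,\theta_{s})\in\mathbb{R}^{s}$. The coordinates of $\boldsymbol{\theta}$ are algebraically dependent (over $\mathbb{Q}$) if and only if ${}^{\ast}\mathbb{Z}[\boldsymbol{X}](\boldsymbol{\theta})$ contains a nonzero ideal $I$ of ${}^{\ast}\mathbb{Z}[\boldsymbol{X}]$; and in the latter case there is a maximal such ideal $I(\boldsymbol{\theta})=\mathrm{Ker}(\varepsilon^{\mathrm{poly}}(\boldsymbol{\theta}))$.
   Context: Fix a non-principal ultrafilter on $\mathbb{N}$; ${}^{\ast}\mathbb{Z}\subset{}^{\ast}\mathbb{R}$ are the ultrapowers of $\mathbb{Z}$, $\mathbb{R}$ and ${}^{\ast}\mathbb{R}_{\varepsilon}$ is the group of infinitesimals. ${}^{\ast}\mathbb{Z}[\boldsymbol{X}]$, $\boldsymbol{X}=(X_{1},\dots,X_{s})$, is the ordinary polynomial ring with coefficients in ${}^{\ast}\mathbb{Z}$. Define ${}^{\ast}\mathbb{Z}[\boldsymbol{X}](\boldsymbol{\theta})=\{F\in{}^{\ast}\mathbb{Z}[\boldsymbol{X}]\mid F(\boldsymbol{\theta})\in{}^{\ast}\mathbb{R}_{\varepsilon}\}$ and the error map $\varepsilon^{\mathrm{poly}}(\boldsymbol{\theta}):{}^{\ast}\mathbb{Z}[\boldsymbol{X}](\boldsymbol{\theta})\to{}^{\ast}\mathbb{R}_{\varepsilon}$, $F\mapsto F(\boldsymbol{\theta})$. *)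

theory Defs
  imports
    "HOL-Analysis.Finite_Cartesian_Product"
    "HOL-Algebra.Algebraic_Closure_Type"
    "HOL-Library.Function_Algebras"
begin

section \<open>Ultrapowers over the natural numbers\<close>

text \<open>A set \<open>A\<close> of naturals belongs to the filter \<open>U\<close> iff \<open>eventually (\<lambda>n. n \<in> A) U\<close>;
  the principal ultrafilters are the filters \<open>principal {n}\<close>.\<close>

definition nonprincipal_ultrafilter :: "nat filter \<Rightarrow> bool" where
  "nonprincipal_ultrafilter U \<longleftrightarrow>
     U \<noteq> bot \<and> (\<forall>P. eventually P U \<or> eventually (\<lambda>n. \<not> P n) U) \<and> (\<forall>n. U \<noteq> principal {n})"

definition null_seqs :: "nat filter \<Rightarrow> (nat \<Rightarrow> 'a::comm_ring_1) set" where
  "null_seqs U = {f. eventually (\<lambda>n. f n = 0) U}"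

text \<open>The ring of all sequences (with the pointwise operations) modulo equality
  \<open>U\<close>-almost everywhere. An element is a coset, i.e. an equivalence class of sequences.\<close>

definition ultrapower :: "nat filter \<Rightarrow> (nat \<Rightarrow> 'a::comm_ring_1) set ring" where
  "ultrapower U = ring_of_type_algebra Quot null_seqs U"

definition germ :: "nat filter \<Rightarrow> (nat \<Rightarrow> 'a) \<Rightarrow> (nat \<Rightarrow> 'a) set" where
  "germ U f = {g. eventually (\<lambda>n. g n = f n) U}"

lemma coset_null_seqs:
  "null_seqs U +>\<^bsub>ring_of_type_algebra\<^esub> f = germ U (f :: nat \<Rightarrow> 'a::comm_ring_1)"
proof (intro equalityI subsetI)
  fix g assume "g \<in> null_seqs U +>\<^bsub>ring_of_type_algebra\<^esub> f"
  then obtain h where "h \<in> null_seqs U" "g = h + f"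
    by (auto simp: a_r_coset_def r_coset_def ring_of_type_algebra_def)
  then show "g \<in> germ U f" by (simp add: null_seqs_def germ_def)
next
  fix g assume "g \<in> germ U f"
  then have "\<exists>h\<in>null_seqs U. g = h + f"
    by (intro bexI[of _ "g - f"]) (simp_all add: null_seqs_def germ_def)
  then show "g \<in> null_seqs U +>\<^bsub>ring_of_type_algebra\<^esub> f"
    by (auto simp: a_r_coset_def r_coset_def ring_of_type_algebra_def)
qed

lemma ideal_null_seqs: "ideal (null_seqs U :: (nat \<Rightarrow> 'a::comm_ring_1) set) ring_of_type_algebra"
proof -
  let ?R = "ring_of_type_algebra :: (nat \<Rightarrow> 'a) ring"
  let ?I = "null_seqs U :: (nat \<Rightarrow> 'a) set"
  interpret R: ring ?R by (rule ring_from_type_algebra)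
  have minus: "\<ominus>\<^bsub>?R\<^esub> f = - f" for f
    using R.minus_equality[of "- f" f] by (simp add: ring_of_type_algebra_def)
  have "subgroup ?I (add_monoid ?R)"
  proof (rule R.add.subgroupI)
    show "?I \<noteq> {}" by (auto simp: null_seqs_def intro!: exI[of _ "\<lambda>_. 0"])
    show "\<ominus>\<^bsub>?R\<^esub> f \<in> ?I" if "f \<in> ?I" for f
      using that by (simp add: minus null_seqs_def)
    show "f \<oplus>\<^bsub>?R\<^esub> g \<in> ?I" if "f \<in> ?I" "g \<in> ?I" for f g
      using that by (auto simp: null_seqs_def ring_of_type_algebra_def elim: eventually_elim2)
  qed (simp add: ring_of_type_algebra_def)
  then show ?thesis
    by (intro idealI ring_from_type_algebra)
      (auto simp: null_seqs_def ring_of_type_algebra_def elim: eventually_mono)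
qed

lemma cring_ultrapower: "cring (ultrapower U :: (nat \<Rightarrow> 'a::comm_ring_1) set ring)"
  unfolding ultrapower_def by (rule ideal.quotient_is_cring[OF ideal_null_seqs cring_from_type_algebra])

lemma ultrapower_simps:
  fixes f g :: "nat \<Rightarrow> 'a::comm_ring_1"
  shows "carrier (ultrapower U :: (nat \<Rightarrow> 'a) set ring) = range (germ U)"
    and "\<zero>\<^bsub>ultrapower U\<^esub> = germ U (\<lambda>_. 0 :: 'a)"
    and "\<one>\<^bsub>ultrapower U\<^esub> = germ U (\<lambda>_. 1 :: 'a)"
    and "germ U f \<oplus>\<^bsub>ultrapower U\<^esub> germ U g = germ U (\<lambda>n. f n + g n)"
    and "germ U f \<otimes>\<^bsub>ultrapower U\<^esub> germ U g = germ U (\<lambda>n. f n * g n)"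
proof -
  let ?R = "ring_of_type_algebra :: (nat \<Rightarrow> 'a) ring"
  interpret ideal "null_seqs U :: (nat \<Rightarrow> 'a) set" ?R by (rule ideal_null_seqs)
  have [simp]: "carrier ?R = UNIV" by (simp add: ring_of_type_algebra_def)
  show "carrier (ultrapower U :: (nat \<Rightarrow> 'a) set ring) = range (germ U)"
    by (auto simp: ultrapower_def FactRing_def A_RCOSETS_def' coset_null_seqs)
  show "\<zero>\<^bsub>ultrapower U\<^esub> = germ U (\<lambda>_. 0 :: 'a)"
    by (simp add: ultrapower_def FactRing_def null_seqs_def germ_def)
  show "\<one>\<^bsub>ultrapower U\<^esub> = germ U (\<lambda>_. 1 :: 'a)"
    by (simp add: ultrapower_def FactRing_def coset_null_seqs)
      (simp add: ring_of_type_algebra_def one_fun_def)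
  show "germ U f \<oplus>\<^bsub>ultrapower U\<^esub> germ U g = germ U (\<lambda>n. f n + g n)"
    using a_rcos_sum[of f g]
    by (simp add: ultrapower_def FactRing_def coset_null_seqs)
      (simp add: ring_of_type_algebra_def plus_fun_def)
  show "germ U f \<otimes>\<^bsub>ultrapower U\<^esub> germ U g = germ U (\<lambda>n. f n * g n)"
    using rcoset_mult_add[of f g]
    by (simp add: ultrapower_def FactRing_def coset_null_seqs)
      (simp add: ring_of_type_algebra_def times_fun_def)
qed

text \<open>The inclusions of the reals and of the hyperintegers into the hyperreals.\<close>

definition hyperreal_of_real :: "nat filter \<Rightarrow> real \<Rightarrow> (nat \<Rightarrow> real) set" where
  "hyperreal_of_real U r = germ U (\<lambda>_. r)"

definition hyperreal_of_hyperint :: "nat filter \<Rightarrow> (nat \<Rightarrow> int) set \<Rightarrow> (nat \<Rightarrow> real) set" where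
  "hyperreal_of_hyperint U a = (\<Union>f\<in>a. germ U (\<lambda>n. real_of_int (f n)))"

lemma hyperreal_of_hyperint_germ:
  "hyperreal_of_hyperint U (germ U f) = germ U (\<lambda>n. real_of_int (f n))"
proof -
  have "germ U (\<lambda>n. real_of_int (g n)) = germ U (\<lambda>n. real_of_int (f n))" if "g \<in> germ U f" for g
    using that unfolding germ_def by (auto elim: eventually_elim2)
  moreover have "f \<in> germ U f" by (simp add: germ_def)
  ultimately show ?thesis unfolding hyperreal_of_hyperint_def by blast
qed

definition hyperreal_less :: "nat filter \<Rightarrow> (nat \<Rightarrow> real) set \<Rightarrow> (nat \<Rightarrow> real) set \<Rightarrow> bool" where
  "hyperreal_less U x y \<longleftrightarrow> (\<exists>f\<in>x. \<exists>g\<in>y. eventually (\<lambda>n. f n < g n) U)"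

definition infinitesimals :: "nat filter \<Rightarrow> (nat \<Rightarrow> real) set set" where
  "infinitesimals U = {x \<in> carrier (ultrapower U). \<forall>r>0.
     hyperreal_less U (hyperreal_of_real U (- r)) x \<and> hyperreal_less U x (hyperreal_of_real U r)}"


section \<open>Multivariate polynomials over a ring\<close>

text \<open>As in \<^theory>\<open>HOL-Algebra.Indexed_Polynomials\<close>, a monomial in the variables indexed by
  \<open>'n\<close> is a multiset of variables, and a polynomial is its coefficient function.\<close>

definition mpoly_ring :: "('a, 'b) ring_scheme \<Rightarrow> ('n multiset \<Rightarrow> 'a) ring" where
  "mpoly_ring R = \<lparr>
     carrier = {p. (\<forall>m. p m \<in> carrier R) \<and> finite {m. p m \<noteq> \<zero>\<^bsub>R\<^esub>}},
     monoid.mult = (\<lambda>p q m. \<Oplus>\<^bsub>R\<^esub>k\<in>{k. k \<subseteq># m}. p k \<otimes>\<^bsub>R\<^esub> q (m - k)),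
     one = (\<lambda>m. if m = {#} then \<one>\<^bsub>R\<^esub> else \<zero>\<^bsub>R\<^esub>),
     zero = (\<lambda>m. \<zero>\<^bsub>R\<^esub>),
     add = (\<lambda>p q m. p m \<oplus>\<^bsub>R\<^esub> q m)\<rparr>"

text \<open>Evaluation at the point \<open>x\<close> of \<open>S\<close>-space, the coefficients being mapped to \<open>S\<close> by \<open>h\<close>.\<close>

definition mpoly_eval ::
    "('a, 'b) ring_scheme \<Rightarrow> ('c, 'd) ring_scheme \<Rightarrow> ('a \<Rightarrow> 'c) \<Rightarrow> ('n::finite \<Rightarrow> 'c)
      \<Rightarrow> ('n multiset \<Rightarrow> 'a) \<Rightarrow> 'c" where
  "mpoly_eval R S h x p = (\<Oplus>\<^bsub>S\<^esub>m\<in>{m. p m \<noteq> \<zero>\<^bsub>R\<^esub>}.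
     h (p m) \<otimes>\<^bsub>S\<^esub> (\<Otimes>\<^bsub>S\<^esub>i\<in>UNIV. x i [^]\<^bsub>S\<^esub> count m i))"

definition algebraically_dependent_over_rat :: "real ^ 'n \<Rightarrow> bool" where
  "algebraically_dependent_over_rat \<theta> \<longleftrightarrow>
     (\<exists>p \<in> carrier (mpoly_ring (ring_of_type_algebra :: rat ring)).
        p \<noteq> \<zero>\<^bsub>mpoly_ring (ring_of_type_algebra :: rat ring)\<^esub> \<and>
        mpoly_eval ring_of_type_algebra ring_of_type_algebra of_rat (\<lambda>i. \<theta> $ i) p = 0)"


section \<open>Hyperinteger polynomials with infinitesimal value\<close>

definition hyperint_polys :: "nat filter \<Rightarrow> ('n multiset \<Rightarrow> (nat \<Rightarrow> int) set) ring" where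
  "hyperint_polys U = mpoly_ring (ultrapower U)"

definition hyper_eval ::
    "nat filter \<Rightarrow> real ^ 'n \<Rightarrow> ('n multiset \<Rightarrow> (nat \<Rightarrow> int) set) \<Rightarrow> (nat \<Rightarrow> real) set" where
  "hyper_eval U \<theta> = mpoly_eval (ultrapower U) (ultrapower U)
     (hyperreal_of_hyperint U) (\<lambda>i. hyperreal_of_real U (\<theta> $ i))"

definition dioph_polys ::
    "nat filter \<Rightarrow> real ^ 'n \<Rightarrow> ('n multiset \<Rightarrow> (nat \<Rightarrow> int) set) set" where
  "dioph_polys U \<theta> = {F \<in> carrier (hyperint_polys U). hyper_eval U \<theta> F \<in> infinitesimals U}"

definition error_map ::
    "nat filter \<Rightarrow> real ^ 'n \<Rightarrow> ('n multiset \<Rightarrow> (nat \<Rightarrow> int) set) \<Rightarrow> (nat \<Rightarrow> real) set" where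
  "error_map U \<theta> = (\<lambda>F \<in> dioph_polys U \<theta>. hyper_eval U \<theta> F)"

text \<open>The kernel of the error map as a map of additive groups: \<open>dioph_polys U \<theta>\<close> is not
  closed under multiplication by arbitrary polynomials, and only the additive structure of the
  two restricted records is used.\<close>

definition error_kernel ::
    "nat filter \<Rightarrow> real ^ 'n \<Rightarrow> ('n multiset \<Rightarrow> (nat \<Rightarrow> int) set) set" where
  "error_kernel U \<theta> = a_kernel (hyperint_polys U \<lparr>carrier := dioph_polys U \<theta>\<rparr>)
     (ultrapower U \<lparr>carrier := infinitesimals U\<rparr>) (error_map U \<theta>)"

definition nonzero_ideals_within ::
    "('a, 'b) ring_scheme \<Rightarrow> 'a set \<Rightarrow> 'a set set" where
  "nonzero_ideals_within R S = {I. ideal I R \<and> I \<noteq> {\<zero>\<^bsub>R\<^esub>} \<and> I \<subseteq> S}"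

end

theory Submission
  imports Defs
begin

text \<open>An ideal is closed under multiplication by every constant hyperinteger \<open>N\<close>. If \<open>F\<close> lies in an
  ideal all of whose elements are infinitesimal at \<open>\<theta>\<close>, then \<open>N F(\<theta>)\<close> is infinitesimal for
  every \<open>N\<close>, however large, and taking \<open>N\<close> of size at least \<open>1 / \<bar>F(\<theta>)\<bar>\<close> shows that this is
  possible only if \<open>F(\<theta>) = 0\<close> (\<open>infinitesimal_multiples_imp_zero\<close>, \<open>ideal_subset_error_kernel\<close>).
  Every ideal of this kind is therefore contained in the kernel of the error map. Conversely the
  kernel is itself such an ideal, because it is the kernel of the evaluation homomorphism
  \<open>F \<mapsto> F(\<theta>)\<close> on all of the polynomial ring (\<open>error_kernel_eq\<close>). So a nonzero ideal of this
  kind exists iff the kernel is nonzero, and then the kernel is the largest one.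

  It remains to see that the kernel is nonzero iff the coordinates of \<open>\<theta>\<close> are algebraically
  dependent (\<open>algebraically_dependent_iff_error_kernel_nonzero\<close>). An integral polynomial relation,
  read as a polynomial with constant sequences as coefficients, lies in the kernel. In the other
  direction, a polynomial over the hyperintegers has only finitely many monomials, so choosing a
  representing sequence for each coefficient presents it as a sequence of integer polynomials with
  supports in one finite set. If its value is zero, almost all members of the sequence
  vanish at \<open>\<theta>\<close>; if it is nonzero, at least one of these members is a nonzero polynomial.

  Underlying all this are two facts of commutative algebra: multivariate polynomials, multiplied by
  convolution of coefficient functions, form a commutative ring (\<open>cring_mpoly_ring\<close>), and
  evaluation at a point is a ring homomorphism (\<open>mpoly_eval_ring_hom\<close>).\<close>

section \<open>Finite sums in abelian monoids and over submultisets\<close>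

lemma finite_submultisets: "finite {k. k \<subseteq># m}"
proof (induction m)
  case (add x m)
  have "{k. k \<subseteq># add_mset x m} \<subseteq> {k. k \<subseteq># m} \<union> add_mset x ` {k. k \<subseteq># m}"
  proof
    fix k assume "k \<in> {k. k \<subseteq># add_mset x m}"
    then have k: "k \<subseteq># add_mset x m" by simp
    show "k \<in> {k. k \<subseteq># m} \<union> add_mset x ` {k. k \<subseteq># m}"
    proof (cases "x \<in># k")
      case True
      then obtain l where "k = add_mset x l" by (metis insert_DiffM)
      with k show ?thesis by auto
    next
      case False
      with k show ?thesis
        by (metis UnI1 diff_single_trivial mem_Collect_eq subset_eq_diff_conv add_mset_add_single)
    qed
  qed
  with add show ?case by (meson finite_UnI finite_imageI finite_subset)
qed simp

context abelian_monoid
begin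

lemma finsum_Sigma:
  assumes "finite A" "\<And>i. i \<in> A \<Longrightarrow> finite (B i)"
    and closed: "\<And>i j. i \<in> A \<Longrightarrow> j \<in> B i \<Longrightarrow> f i j \<in> carrier G"
  shows "(\<Oplus>i\<in>A. \<Oplus>j\<in>B i. f i j) = finsum G (\<lambda>(i, j). f i j) (Sigma A B)"
proof -
  have "finsum G (\<lambda>(i, j). f i j) (Sigma A B) = (\<Oplus>z\<in>(\<Union>i\<in>A. Pair i ` B i). case z of (i, j) \<Rightarrow> f i j)"
    by (rule arg_cong[where f = "finsum G _"]) auto
  also have "\<dots> = (\<Oplus>i\<in>A. \<Oplus>z\<in>Pair i ` B i. case z of (i, j) \<Rightarrow> f i j)"
    by (rule add.finprod_UN_disjoint) (use assms in \<open>auto simp: pairwise_def disjnt_def\<close>)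
  also have "\<dots> = (\<Oplus>i\<in>A. \<Oplus>j\<in>B i. f i j)"
  proof (rule add.finprod_cong')
    fix i assume "i \<in> A"
    then show "(\<Oplus>z\<in>Pair i ` B i. case z of (i, j) \<Rightarrow> f i j) = (\<Oplus>j\<in>B i. f i j)"
      by (subst add.finprod_reindex) (auto simp: inj_on_def closed)
  qed (auto simp: closed)
  finally show ?thesis by simp
qed

lemma finsum_bij:
  assumes "bij_betw h A B" "\<And>y. y \<in> B \<Longrightarrow> f y \<in> carrier G" "\<And>x. x \<in> A \<Longrightarrow> g x = f (h x)"
  shows "finsum G g A = finsum G f B"
proof -
  have "finsum G f B = (\<Oplus>x\<in>A. f (h x))"
    using add.finprod_reindex[of f h A] assms by (auto simp: bij_betw_def)
  also have "\<dots> = finsum G g A"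
    by (rule add.finprod_cong') (use assms in \<open>auto simp: bij_betw_def\<close>)
  finally show ?thesis by simp
qed

lemma finsum_antidiagonal_swap:
  assumes "\<And>k l. f k l \<in> carrier G"
  shows "(\<Oplus>k\<in>{k. k \<subseteq># m}. f k (m - k)) = (\<Oplus>k\<in>{k. k \<subseteq># m}. f (m - k) k)"
  by (rule finsum_bij[where h = "\<lambda>k. m - k"], rule bij_betw_byWitness[where f' = "\<lambda>k. m - k"])
    (auto simp: assms subset_mset.diff_diff_right)

text \<open>The three-fold splittings \<open>j + l + r = m\<close> can be enumerated by first choosing \<open>j + l\<close> or
  by first choosing \<open>j\<close>; this is the combinatorial content of associativity of convolution.\<close>

lemma finsum_antidiagonal_assoc:
  assumes "\<And>j l r. f j l r \<in> carrier G"
  shows "(\<Oplus>k\<in>{k. k \<subseteq># m}. \<Oplus>j\<in>{j. j \<subseteq># k}. f j (k - j) (m - k)) =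
    (\<Oplus>j\<in>{j. j \<subseteq># m}. \<Oplus>l\<in>{l. l \<subseteq># m - j}. f j l (m - j - l))"
  unfolding finsum_Sigma[OF finite_submultisets finite_submultisets assms]
proof (rule finsum_bij[where h = "\<lambda>(k, j). (j, k - j)"])
  have split: "j \<subseteq># m \<and> k - j \<subseteq># m - j \<and> m - j - (k - j) = m - k" if "k \<subseteq># m" "j \<subseteq># k" for j k
  proof -
    from that obtain c d where "k = j + c" "m = j + c + d"
      by (metis subset_mset.le_iff_add)
    then show ?thesis by (simp add: add.assoc)
  qed
  have join: "j + l \<subseteq># m" if "j \<subseteq># m" "l \<subseteq># m - j" for j l
    using that by (simp add: subset_mset.le_diff_conv2 add.commute)
  show "bij_betw (\<lambda>(k, j). (j, k - j)) (SIGMA k:{k. k \<subseteq># m}. {j. j \<subseteq># k})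
      (SIGMA j:{j. j \<subseteq># m}. {l. l \<subseteq># m - j})"
    by (rule bij_betw_byWitness[where f' = "\<lambda>(j, l). (j + l, j)"]) (auto simp: split join)
  show "(case x of (k, j) \<Rightarrow> f j (k - j) (m - k)) =
      (case case x of (k, j) \<Rightarrow> (j, k - j) of (j, l) \<Rightarrow> f j l (m - j - l))"
    if "x \<in> (SIGMA k:{k. k \<subseteq># m}. {j. j \<subseteq># k})" for x
    using that split by auto
qed (auto simp: assms)

text \<open>The pairs \<open>(a, b)\<close> embed into the index set of the left-hand side by \<open>(a, b) \<mapsto> (a + b, a)\<close>,
  and all terms outside the image vanish. This turns a product of two polynomial values into the
  value of the convolution.\<close>

lemma finsum_antidiagonals:
  assumes fin: "finite A" "finite B" "finite C" and sub: "\<And>a b. a \<in> A \<Longrightarrow> b \<in> B \<Longrightarrow> a + b \<in> C"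
    and closed: "\<And>k l. f k l \<in> carrier G"
    and zero: "\<And>k l. k \<notin> A \<or> l \<notin> B \<Longrightarrow> f k l = \<zero>"
  shows "(\<Oplus>m\<in>C. \<Oplus>k\<in>{k. k \<subseteq># m}. f k (m - k)) = (\<Oplus>a\<in>A. \<Oplus>b\<in>B. f a b)"
proof -
  let ?h = "\<lambda>(a, b). (a + b, a)"
  let ?S = "SIGMA m:C. {k. k \<subseteq># m}"
  have "(\<Oplus>m\<in>C. \<Oplus>k\<in>{k. k \<subseteq># m}. f k (m - k)) = finsum G (\<lambda>(m, k). f k (m - k)) ?S"
    by (rule finsum_Sigma) (auto simp: fin finite_submultisets closed)
  also have "\<dots> = finsum G (\<lambda>(m, k). f k (m - k)) (?h ` (A \<times> B))"
  proof (rule add.finprod_mono_neutral_cong_right)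
    show "finite ?S" using fin finite_submultisets by auto
    show "?h ` (A \<times> B) \<subseteq> ?S" using sub by auto
    show "(case i of (m, k) \<Rightarrow> f k (m - k)) = \<zero>" if "i \<in> ?S - ?h ` (A \<times> B)" for i
    proof -
      obtain m k where i: "i = (m, k)" by fastforce
      with that have "k \<subseteq># m" by auto
      then have "i = ?h (k, m - k)" by (simp add: i)
      with that have "(k, m - k) \<notin> A \<times> B" by blast
      then show ?thesis using zero by (auto simp: i)
    qed
  qed (auto simp: closed)
  also have "\<dots> = finsum G (\<lambda>(a, b). f a b) (A \<times> B)"
    by (rule finsum_bij[symmetric, where h = ?h]) (auto simp: bij_betw_def inj_on_def closed)
  also have "\<dots> = (\<Oplus>a\<in>A. \<Oplus>b\<in>B. f a b)"
    by (rule finsum_Sigma[symmetric]) (auto simp: fin closed)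
  finally show ?thesis .
qed

end


section \<open>The ring of multivariate polynomials and its evaluation homomorphisms\<close>

lemma mpoly_ring_simps:
  "carrier (mpoly_ring R) = {p. (\<forall>m. p m \<in> carrier R) \<and> finite {m. p m \<noteq> \<zero>\<^bsub>R\<^esub>}}"
  "\<zero>\<^bsub>mpoly_ring R\<^esub> = (\<lambda>m. \<zero>\<^bsub>R\<^esub>)"
  "\<one>\<^bsub>mpoly_ring R\<^esub> = (\<lambda>m. if m = {#} then \<one>\<^bsub>R\<^esub> else \<zero>\<^bsub>R\<^esub>)"
  "p \<oplus>\<^bsub>mpoly_ring R\<^esub> q = (\<lambda>m. p m \<oplus>\<^bsub>R\<^esub> q m)"
  "p \<otimes>\<^bsub>mpoly_ring R\<^esub> q = (\<lambda>m. \<Oplus>\<^bsub>R\<^esub>k\<in>{k. k \<subseteq># m}. p k \<otimes>\<^bsub>R\<^esub> q (m - k))"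
  by (simp_all add: mpoly_ring_def)

context cring
begin

lemma mpoly_mult_support:
  assumes "p \<in> carrier (mpoly_ring R)" "q \<in> carrier (mpoly_ring R)"
  shows "{m. (p \<otimes>\<^bsub>mpoly_ring R\<^esub> q) m \<noteq> \<zero>} \<subseteq>
    (\<lambda>(a, b). a + b) ` ({m. p m \<noteq> \<zero>} \<times> {m. q m \<noteq> \<zero>})"
proof (rule subsetI, rule ccontr)
  fix m
  assume m: "m \<in> {m. (p \<otimes>\<^bsub>mpoly_ring R\<^esub> q) m \<noteq> \<zero>}"
    and no: "m \<notin> (\<lambda>(a, b). a + b) ` ({m. p m \<noteq> \<zero>} \<times> {m. q m \<noteq> \<zero>})"
  have "p k \<otimes> q (m - k) = \<zero>" if "k \<subseteq># m" for k
  proof -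
    have "m = (case (k, m - k) of (a, b) \<Rightarrow> a + b)" using that by simp
    with no have "(k, m - k) \<notin> {m. p m \<noteq> \<zero>} \<times> {m. q m \<noteq> \<zero>}" by blast
    then have "p k = \<zero> \<or> q (m - k) = \<zero>" by simp
    with assms show ?thesis by (auto simp: mpoly_ring_simps)
  qed
  then have "(p \<otimes>\<^bsub>mpoly_ring R\<^esub> q) m = \<zero>"
    unfolding mpoly_ring_simps by (intro add.finprod_one_eqI) simp
  with m show False by simp
qed

lemma mpoly_mult_closed:
  assumes "p \<in> carrier (mpoly_ring R)" "q \<in> carrier (mpoly_ring R)"
  shows "p \<otimes>\<^bsub>mpoly_ring R\<^esub> q \<in> carrier (mpoly_ring R)"
proof -
  have "finite {m. (p \<otimes>\<^bsub>mpoly_ring R\<^esub> q) m \<noteq> \<zero>}"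
    by (rule finite_subset[OF mpoly_mult_support[OF assms]])
      (use assms in \<open>auto simp: mpoly_ring_simps\<close>)
  then show ?thesis using assms by (auto simp: mpoly_ring_simps intro!: finsum_closed)
qed

lemma mpoly_mult_assoc:
  assumes "p \<in> carrier (mpoly_ring R)" "q \<in> carrier (mpoly_ring R)" "r \<in> carrier (mpoly_ring R)"
  shows "p \<otimes>\<^bsub>mpoly_ring R\<^esub> q \<otimes>\<^bsub>mpoly_ring R\<^esub> r =
    p \<otimes>\<^bsub>mpoly_ring R\<^esub> (q \<otimes>\<^bsub>mpoly_ring R\<^esub> r)"
proof
  fix m
  have [simp]: "p k \<in> carrier R" "q k \<in> carrier R" "r k \<in> carrier R" for k
    using assms by (auto simp: mpoly_ring_simps)
  have "(p \<otimes>\<^bsub>mpoly_ring R\<^esub> q \<otimes>\<^bsub>mpoly_ring R\<^esub> r) m =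
      (\<Oplus>k\<in>{k. k \<subseteq># m}. \<Oplus>j\<in>{j. j \<subseteq># k}. p j \<otimes> q (k - j) \<otimes> r (m - k))"
    unfolding mpoly_ring_simps
    by (intro add.finprod_cong' refl finsum_ldistr finite_submultisets) (auto intro!: finsum_closed)
  also have "\<dots> = (\<Oplus>j\<in>{j. j \<subseteq># m}. \<Oplus>l\<in>{l. l \<subseteq># m - j}. p j \<otimes> q l \<otimes> r (m - j - l))"
    by (rule finsum_antidiagonal_assoc) simp
  also have "\<dots> = (p \<otimes>\<^bsub>mpoly_ring R\<^esub> (q \<otimes>\<^bsub>mpoly_ring R\<^esub> r)) m"
    unfolding mpoly_ring_simps
    by (intro add.finprod_cong' refl)
      (auto simp: finsum_rdistr finite_submultisets m_assoc intro!: finsum_closed add.finprod_cong')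
  finally show "(p \<otimes>\<^bsub>mpoly_ring R\<^esub> q \<otimes>\<^bsub>mpoly_ring R\<^esub> r) m =
      (p \<otimes>\<^bsub>mpoly_ring R\<^esub> (q \<otimes>\<^bsub>mpoly_ring R\<^esub> r)) m" .
qed

lemma mpoly_mult_comm:
  assumes "p \<in> carrier (mpoly_ring R)" "q \<in> carrier (mpoly_ring R)"
  shows "p \<otimes>\<^bsub>mpoly_ring R\<^esub> q = q \<otimes>\<^bsub>mpoly_ring R\<^esub> p"
proof
  fix m
  have [simp]: "p k \<in> carrier R" "q k \<in> carrier R" for k
    using assms by (auto simp: mpoly_ring_simps)
  show "(p \<otimes>\<^bsub>mpoly_ring R\<^esub> q) m = (q \<otimes>\<^bsub>mpoly_ring R\<^esub> p) m"
    unfolding mpoly_ring_simps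
    by (subst finsum_antidiagonal_swap) (auto intro!: add.finprod_cong' simp: m_comm)
qed

lemma mpoly_one_mult:
  assumes "p \<in> carrier (mpoly_ring R)"
  shows "\<one>\<^bsub>mpoly_ring R\<^esub> \<otimes>\<^bsub>mpoly_ring R\<^esub> p = p"
proof
  fix m
  have [simp]: "p k \<in> carrier R" for k
    using assms by (auto simp: mpoly_ring_simps)
  have "(\<one>\<^bsub>mpoly_ring R\<^esub> \<otimes>\<^bsub>mpoly_ring R\<^esub> p) m = (\<Oplus>k\<in>{{#}}. p (m - k))"
    unfolding mpoly_ring_simps
    by (rule add.finprod_mono_neutral_cong_right) (auto simp: finite_submultisets)
  also have "\<dots> = p m" by simp
  finally show "(\<one>\<^bsub>mpoly_ring R\<^esub> \<otimes>\<^bsub>mpoly_ring R\<^esub> p) m = p m" .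
qed

lemma finite_add_support:
  assumes "finite {m. p m \<noteq> \<zero>}" "finite {m. q m \<noteq> \<zero>}"
  shows "finite {m. p m \<oplus> q m \<noteq> \<zero>}"
  by (rule finite_subset[OF _ finite_UnI[OF assms]]) auto

theorem cring_mpoly_ring: "cring (mpoly_ring R)"
proof (rule cringI)
  show "abelian_group (mpoly_ring R)"
  proof (rule abelian_groupI)
    fix p assume p: "p \<in> carrier (mpoly_ring R)"
    have "(\<lambda>m. \<ominus> p m) \<in> carrier (mpoly_ring R)"
      using p by (auto simp: mpoly_ring_simps elim!: rev_finite_subset)
    moreover have "(\<lambda>m. \<ominus> p m) \<oplus>\<^bsub>mpoly_ring R\<^esub> p = \<zero>\<^bsub>mpoly_ring R\<^esub>"
      using p by (auto simp: mpoly_ring_simps l_neg)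
    ultimately show "\<exists>q\<in>carrier (mpoly_ring R). q \<oplus>\<^bsub>mpoly_ring R\<^esub> p = \<zero>\<^bsub>mpoly_ring R\<^esub>" by blast
  qed (auto simp: mpoly_ring_simps finite_add_support a_ac)
  show "comm_monoid (mpoly_ring R)"
    by (rule comm_monoidI)
      (auto intro: mpoly_mult_closed mpoly_mult_assoc mpoly_one_mult mpoly_mult_comm,
        auto simp: mpoly_ring_simps)
  show "(p \<oplus>\<^bsub>mpoly_ring R\<^esub> q) \<otimes>\<^bsub>mpoly_ring R\<^esub> r =
      p \<otimes>\<^bsub>mpoly_ring R\<^esub> r \<oplus>\<^bsub>mpoly_ring R\<^esub> q \<otimes>\<^bsub>mpoly_ring R\<^esub> r"
    if "p \<in> carrier (mpoly_ring R)" "q \<in> carrier (mpoly_ring R)" "r \<in> carrier (mpoly_ring R)"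
    for p q r
  proof
    fix m
    have [simp]: "p k \<in> carrier R" "q k \<in> carrier R" "r k \<in> carrier R" for k
      using that by (auto simp: mpoly_ring_simps)
    show "((p \<oplus>\<^bsub>mpoly_ring R\<^esub> q) \<otimes>\<^bsub>mpoly_ring R\<^esub> r) m =
        (p \<otimes>\<^bsub>mpoly_ring R\<^esub> r \<oplus>\<^bsub>mpoly_ring R\<^esub> q \<otimes>\<^bsub>mpoly_ring R\<^esub> r) m"
      unfolding mpoly_ring_simps by (simp add: l_distr Pi_def finsum_addf)
  qed
qed

end

context ring_hom_cring
begin

text \<open>The support of a sum or product of polynomials is not determined by the supports of the
  operands; summing over a superset makes the values comparable term by term.\<close>

lemma mpoly_eval_supset:
  assumes "p \<in> carrier (mpoly_ring R)" "\<And>i. x i \<in> carrier S"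
    and "finite A" "{m. p m \<noteq> \<zero>} \<subseteq> A"
  shows "mpoly_eval R S h x p = (\<Oplus>\<^bsub>S\<^esub>m\<in>A. h (p m) \<otimes>\<^bsub>S\<^esub> (\<Otimes>\<^bsub>S\<^esub>i\<in>UNIV. x i [^]\<^bsub>S\<^esub> count m i))"
  unfolding mpoly_eval_def
  by (rule S.add.finprod_mono_neutral_cong_left)
    (use assms in \<open>auto simp: mpoly_ring_simps intro!: S.m_closed S.finprod_closed\<close>)

text \<open>Multiplicativity rests on the identity \<open>x\<^sup>k\<^sup>+\<^sup>l = x\<^sup>k x\<^sup>l\<close> for monomials: the value of
  the convolution becomes a sum of products along antidiagonals.\<close>

theorem mpoly_eval_ring_hom:
  fixes x :: "'n::finite \<Rightarrow> 'c"
  assumes x: "\<And>i. x i \<in> carrier S"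
  shows "ring_hom_ring (mpoly_ring R) S (mpoly_eval R S h x)"
proof (rule ring_hom_ringI)
  interpret P: cring "mpoly_ring R :: ('n multiset \<Rightarrow> 'a) ring" by (rule R.cring_mpoly_ring)
  define mon where "mon m = (\<Otimes>\<^bsub>S\<^esub>i\<in>UNIV. x i [^]\<^bsub>S\<^esub> count m i)" for m
  have mon_closed [simp]: "mon m \<in> carrier S" for m
    unfolding mon_def using x by (auto intro!: S.finprod_closed)
  have mon_add: "mon (k + l) = mon k \<otimes>\<^bsub>S\<^esub> mon l" for k l
    unfolding mon_def using x by (simp add: S.nat_pow_mult[symmetric] Pi_def S.finprod_multf)
  have mon_0: "mon {#} = \<one>\<^bsub>S\<^esub>" by (simp add: mon_def)
  note eval = mpoly_eval_supset[where x = x, OF _ x, folded mon_def]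
  show "ring (mpoly_ring R :: ('n multiset \<Rightarrow> 'a) ring)" by (rule P.ring_axioms)
  show "ring S" by (rule S.ring_axioms)
  fix p q :: "'n multiset \<Rightarrow> 'a"
  assume p: "p \<in> carrier (mpoly_ring R)"
  then have pc [simp]: "p m \<in> carrier R" and pfin: "finite {m. p m \<noteq> \<zero>}" for m
    by (auto simp: mpoly_ring_simps)
  show "mpoly_eval R S h x p \<in> carrier S"
    using eval[OF p pfin] by (auto intro!: S.finsum_closed)
  assume q: "q \<in> carrier (mpoly_ring R)"
  then have qc [simp]: "q m \<in> carrier R" and qfin: "finite {m. q m \<noteq> \<zero>}" for m
    by (auto simp: mpoly_ring_simps)
  let ?A = "{m. p m \<noteq> \<zero>}" and ?B = "{m. q m \<noteq> \<zero>}"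
  show "mpoly_eval R S h x (p \<oplus>\<^bsub>mpoly_ring R\<^esub> q) =
      mpoly_eval R S h x p \<oplus>\<^bsub>S\<^esub> mpoly_eval R S h x q"
  proof -
    let ?C = "?A \<union> ?B"
    have "mpoly_eval R S h x (p \<oplus>\<^bsub>mpoly_ring R\<^esub> q) =
        (\<Oplus>\<^bsub>S\<^esub>m\<in>?C. h (p m) \<otimes>\<^bsub>S\<^esub> mon m \<oplus>\<^bsub>S\<^esub> h (q m) \<otimes>\<^bsub>S\<^esub> mon m)"
      by (subst eval[of _ ?C])
        (use p q pfin qfin in \<open>auto simp: mpoly_ring_simps S.l_distr
          intro!: S.add.finprod_cong' R.finite_add_support\<close>)
    also have "\<dots> = mpoly_eval R S h x p \<oplus>\<^bsub>S\<^esub> mpoly_eval R S h x q"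
      using eval[OF p, of ?C] eval[OF q, of ?C] pfin qfin by (simp add: S.finsum_addf Pi_def)
    finally show ?thesis .
  qed
  show "mpoly_eval R S h x (p \<otimes>\<^bsub>mpoly_ring R\<^esub> q) =
      mpoly_eval R S h x p \<otimes>\<^bsub>S\<^esub> mpoly_eval R S h x q"
  proof -
    let ?C = "(\<lambda>(a, b). a + b) ` (?A \<times> ?B)"
    define f where "f k l = (h (p k) \<otimes>\<^bsub>S\<^esub> mon k) \<otimes>\<^bsub>S\<^esub> (h (q l) \<otimes>\<^bsub>S\<^esub> mon l)" for k l
    have f_closed: "f k l \<in> carrier S" for k l by (simp add: f_def)
    have "mpoly_eval R S h x (p \<otimes>\<^bsub>mpoly_ring R\<^esub> q) =
        (\<Oplus>\<^bsub>S\<^esub>m\<in>?C. h (\<Oplus>k\<in>{k. k \<subseteq># m}. p k \<otimes> q (m - k)) \<otimes>\<^bsub>S\<^esub> mon m)"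
      using eval[OF P.m_closed[OF p q], OF _ R.mpoly_mult_support[OF p q]] pfin qfin
      by (simp add: mpoly_ring_simps)
    also have "\<dots> = (\<Oplus>\<^bsub>S\<^esub>m\<in>?C. \<Oplus>\<^bsub>S\<^esub>k\<in>{k. k \<subseteq># m}. f k (m - k))"
    proof (rule S.add.finprod_cong')
      fix m
      have "h (\<Oplus>k\<in>{k. k \<subseteq># m}. p k \<otimes> q (m - k)) \<otimes>\<^bsub>S\<^esub> mon m =
          (\<Oplus>\<^bsub>S\<^esub>k\<in>{k. k \<subseteq># m}. h (p k) \<otimes>\<^bsub>S\<^esub> h (q (m - k)) \<otimes>\<^bsub>S\<^esub> mon m)"
        by (simp add: S.finsum_ldistr finite_submultisets Pi_def comp_def)
      also have "\<dots> = (\<Oplus>\<^bsub>S\<^esub>k\<in>{k. k \<subseteq># m}. f k (m - k))"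
      proof (rule S.add.finprod_cong')
        fix k assume "k \<in> {k. k \<subseteq># m}"
        then have "mon m = mon k \<otimes>\<^bsub>S\<^esub> mon (m - k)" by (simp flip: mon_add)
        then show "h (p k) \<otimes>\<^bsub>S\<^esub> h (q (m - k)) \<otimes>\<^bsub>S\<^esub> mon m = f k (m - k)"
          by (simp add: f_def S.m_ac)
      qed (auto simp: f_closed)
      finally show "h (\<Oplus>k\<in>{k. k \<subseteq># m}. p k \<otimes> q (m - k)) \<otimes>\<^bsub>S\<^esub> mon m =
          (\<Oplus>\<^bsub>S\<^esub>k\<in>{k. k \<subseteq># m}. f k (m - k))" .
    qed (auto intro!: S.finsum_closed simp: f_closed)
    also have "\<dots> = (\<Oplus>\<^bsub>S\<^esub>a\<in>?A. \<Oplus>\<^bsub>S\<^esub>b\<in>?B. f a b)"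
      by (rule S.finsum_antidiagonals) (use pfin qfin in \<open>auto simp: f_closed\<close>, auto simp: f_def)
    also have "\<dots> = (\<Oplus>\<^bsub>S\<^esub>a\<in>?A. h (p a) \<otimes>\<^bsub>S\<^esub> mon a) \<otimes>\<^bsub>S\<^esub> (\<Oplus>\<^bsub>S\<^esub>b\<in>?B. h (q b) \<otimes>\<^bsub>S\<^esub> mon b)"
      unfolding f_def using pfin qfin
      by (subst S.finsum_ldistr)
        (auto intro!: S.add.finprod_cong' S.finsum_closed S.finsum_rdistr[symmetric])
    finally show ?thesis using eval[OF p pfin] eval[OF q qfin] by simp
  qed
next
  have "mpoly_eval R S h x \<one>\<^bsub>mpoly_ring R\<^esub> =
      (\<Oplus>\<^bsub>S\<^esub>m\<in>{{#}}. h \<one> \<otimes>\<^bsub>S\<^esub> (\<Otimes>\<^bsub>S\<^esub>i\<in>UNIV. x i [^]\<^bsub>S\<^esub> count m i))"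
    by (subst mpoly_eval_supset[of _ x "{{#}}"])
      (auto simp: x mpoly_ring_simps)
  then show "mpoly_eval R S h x \<one>\<^bsub>mpoly_ring R\<^esub> = \<one>\<^bsub>S\<^esub>" by simp
qed

end

definition const_mpoly :: "('a, 'b) ring_scheme \<Rightarrow> 'a \<Rightarrow> 'n multiset \<Rightarrow> 'a" where
  "const_mpoly R a = (\<lambda>m. if m = {#} then a else \<zero>\<^bsub>R\<^esub>)"

lemma const_mpoly_closed:
  assumes "cring R" "a \<in> carrier R"
  shows "const_mpoly R a \<in> carrier (mpoly_ring R)"
proof -
  interpret cring R by fact
  have "{m. (if m = {#} then a else \<zero>\<^bsub>R\<^esub>) \<noteq> \<zero>\<^bsub>R\<^esub>} \<subseteq> {{#}}" by auto
  then have "finite {m. (if m = {#} then a else \<zero>\<^bsub>R\<^esub>) \<noteq> \<zero>\<^bsub>R\<^esub>}"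
    by (rule finite_subset) simp
  then show ?thesis using assms(2) by (simp add: const_mpoly_def mpoly_ring_simps)
qed

lemma (in ring_hom_cring) mpoly_eval_const:
  fixes x :: "'n::finite \<Rightarrow> 'c"
  assumes "a \<in> carrier R" "\<And>i. x i \<in> carrier S"
  shows "mpoly_eval R S h x (const_mpoly R a) = h a"
proof -
  have "mpoly_eval R S h x (const_mpoly R a) =
      (\<Oplus>\<^bsub>S\<^esub>m\<in>{{#}}. h a \<otimes>\<^bsub>S\<^esub> (\<Otimes>\<^bsub>S\<^esub>i\<in>UNIV. x i [^]\<^bsub>S\<^esub> count m i))"
    by (subst mpoly_eval_supset[OF const_mpoly_closed[OF R.is_cring assms(1)] assms(2), of "{{#}}"])
      (auto simp: const_mpoly_def assms)
  then show ?thesis using assms(1) by simp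
qed


section \<open>Evaluating hyperinteger polynomials on representatives\<close>

lemma germ_eq_iff: "germ U f = germ U g \<longleftrightarrow> eventually (\<lambda>n. f n = g n) U"
proof
  assume "germ U f = germ U g"
  moreover have "f \<in> germ U f" by (simp add: germ_def)
  ultimately show "eventually (\<lambda>n. f n = g n) U" by (simp add: germ_def)
next
  assume "eventually (\<lambda>n. f n = g n) U"
  then show "germ U f = germ U g"
    by (auto simp: germ_def elim: eventually_elim2)
qed

lemma finsum_germ:
  "finite A \<Longrightarrow> (\<Oplus>\<^bsub>ultrapower U\<^esub>a\<in>A. germ U (f a)) =
    germ U (\<lambda>n. \<Sum>a\<in>A. (f a n :: 'a::comm_ring_1))"
proof (induction A rule: finite_induct)
  case empty
  interpret cring "ultrapower U :: (nat \<Rightarrow> 'a) set ring" by (rule cring_ultrapower)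
  show ?case by (simp add: ultrapower_simps)
next
  case (insert a A)
  interpret cring "ultrapower U :: (nat \<Rightarrow> 'a) set ring" by (rule cring_ultrapower)
  from insert show ?case
    by (subst add.finprod_insert) (auto simp: ultrapower_simps)
qed

lemma finprod_germ:
  "finite A \<Longrightarrow> (\<Otimes>\<^bsub>ultrapower U\<^esub>a\<in>A. germ U (f a)) =
    germ U (\<lambda>n. \<Prod>a\<in>A. (f a n :: 'a::comm_ring_1))"
proof (induction A rule: finite_induct)
  case empty
  interpret cring "ultrapower U :: (nat \<Rightarrow> 'a) set ring" by (rule cring_ultrapower)
  show ?case by (simp add: ultrapower_simps)
next
  case (insert a A)
  interpret cring "ultrapower U :: (nat \<Rightarrow> 'a) set ring" by (rule cring_ultrapower)
  from insert show ?case
    by (subst finprod_insert) (auto simp: ultrapower_simps)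
qed

lemma germ_power:
  "germ U f [^]\<^bsub>ultrapower U\<^esub> k = germ U (\<lambda>n. (f n :: 'a::comm_ring_1) ^ k)" for k :: nat
proof -
  interpret cring "ultrapower U :: (nat \<Rightarrow> 'a) set ring" by (rule cring_ultrapower)
  show ?thesis
    by (induction k) (simp_all add: ultrapower_simps mult.commute)
qed

lemma hyperreal_of_hyperint_hom:
  "ring_hom_cring (ultrapower U) (ultrapower U) (hyperreal_of_hyperint U)"
  by (intro ring_hom_cring.intro ring_hom_cring_axioms.intro cring_ultrapower ring_hom_memI)
    (auto simp: ultrapower_simps hyperreal_of_hyperint_germ)

lemma hyper_eval_ring_hom:
  "ring_hom_ring (hyperint_polys U) (ultrapower U) (hyper_eval U \<theta>)"
  unfolding hyperint_polys_def hyper_eval_def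
  by (rule ring_hom_cring.mpoly_eval_ring_hom[OF hyperreal_of_hyperint_hom])
    (simp add: hyperreal_of_real_def ultrapower_simps)

abbreviation monomial_at :: "real ^ 'n \<Rightarrow> 'n multiset \<Rightarrow> real" where
  "monomial_at \<theta> m \<equiv> \<Prod>i\<in>UNIV. (\<theta> $ i) ^ count m i"

text \<open>This reduces a statement about the value of a hyperinteger polynomial to statements about
  the real values of integer polynomials, one for each index \<open>n\<close>.\<close>

lemma hyper_eval_germ:
  assumes F: "(\<lambda>m. germ U (f m)) \<in> carrier (hyperint_polys U)"
    and A: "finite A" "{m. germ U (f m) \<noteq> germ U (\<lambda>_. 0)} \<subseteq> A"
  shows "hyper_eval U \<theta> (\<lambda>m. germ U (f m)) =
    germ U (\<lambda>n. \<Sum>m\<in>A. real_of_int (f m n) * monomial_at \<theta> m)"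
  unfolding hyper_eval_def
  by (subst ring_hom_cring.mpoly_eval_supset[OF hyperreal_of_hyperint_hom, where A = A])
    (use assms in \<open>auto simp: hyperint_polys_def hyperreal_of_real_def ultrapower_simps
      hyperreal_of_hyperint_germ germ_power finprod_germ finsum_germ\<close>)

lemma hyperint_poly_representatives:
  assumes "F \<in> carrier (hyperint_polys U)"
  obtains f where "F = (\<lambda>m. germ U (f m))" "finite {m. germ U (f m) \<noteq> germ U (\<lambda>_. 0)}"
proof -
  from assms have "\<forall>m. \<exists>g. F m = germ U g" and fin: "finite {m. F m \<noteq> germ U (\<lambda>_. 0)}"
    by (auto simp: hyperint_polys_def mpoly_ring_simps ultrapower_simps)
  then obtain f where "\<forall>m. F m = germ U (f m)" by metis
  with fin that show ?thesis by (metis (mono_tags, lifting) Collect_cong ext)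
qed


section \<open>Infinitesimals\<close>

lemma hyperreal_less_germ:
  "hyperreal_less U (germ U f) (germ U g) \<longleftrightarrow> eventually (\<lambda>n. f n < g n) U"
proof
  assume "hyperreal_less U (germ U f) (germ U g)"
  then obtain f' g' where "eventually (\<lambda>n. f' n = f n) U" "eventually (\<lambda>n. g' n = g n) U"
    "eventually (\<lambda>n. f' n < g' n) U"
    by (auto simp: hyperreal_less_def germ_def)
  then show "eventually (\<lambda>n. f n < g n) U" by eventually_elim simp
next
  assume "eventually (\<lambda>n. f n < g n) U"
  then show "hyperreal_less U (germ U f) (germ U g)"
    unfolding hyperreal_less_def by (intro bexI[of _ f] bexI[of _ g]) (auto simp: germ_def)
qed

lemma germ_infinitesimal_iff:
  "germ U f \<in> infinitesimals U \<longleftrightarrow> (\<forall>r>0. eventually (\<lambda>n. \<bar>f n\<bar> < r) U)"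
proof -
  have "\<bar>f n\<bar> < r \<longleftrightarrow> - r < f n \<and> f n < r" for n r by auto
  then show ?thesis
    by (simp add: infinitesimals_def hyperreal_of_real_def hyperreal_less_germ ultrapower_simps
        eventually_conj_iff)
qed

lemma zero_infinitesimal: "\<zero>\<^bsub>ultrapower U\<^esub> \<in> infinitesimals U"
  by (simp add: ultrapower_simps germ_infinitesimal_iff)

text \<open>A nonzero hyperreal \<open>y\<close> has the hyperinteger multiple \<open>\<lceil>1 / \<bar>y\<bar>\<rceil> y\<close>, whose absolute value
  is at least 1 at every index where the representative of \<open>y\<close> does not vanish; where it does
  vanish, the convention \<open>1 / 0 = 0\<close> makes the multiplier zero.\<close>

lemma infinitesimal_multiples_imp_zero:
  assumes y: "y \<in> carrier (ultrapower U)"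
    and mult: "\<And>N. N \<in> carrier (ultrapower U) \<Longrightarrow>
      hyperreal_of_hyperint U N \<otimes>\<^bsub>ultrapower U\<^esub> y \<in> infinitesimals U"
  shows "y = \<zero>\<^bsub>ultrapower U\<^esub>"
proof -
  from y obtain g where g: "y = germ U g" by (auto simp: ultrapower_simps)
  have "germ U (\<lambda>n. real_of_int \<lceil>1 / \<bar>g n\<bar>\<rceil> * g n) \<in> infinitesimals U"
    using mult[of "germ U (\<lambda>n. \<lceil>1 / \<bar>g n\<bar>\<rceil>)"]
    by (simp add: g ultrapower_simps hyperreal_of_hyperint_germ)
  then have "eventually (\<lambda>n. \<bar>real_of_int \<lceil>1 / \<bar>g n\<bar>\<rceil> * g n\<bar> < 1) U"
    by (simp add: germ_infinitesimal_iff)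
  then have "eventually (\<lambda>n. g n = 0) U"
  proof eventually_elim
    case (elim n)
    show ?case
    proof (rule ccontr)
      assume "g n \<noteq> 0"
      then have "1 = 1 / \<bar>g n\<bar> * \<bar>g n\<bar>" by simp
      also have "\<dots> \<le> \<bar>real_of_int \<lceil>1 / \<bar>g n\<bar>\<rceil>\<bar> * \<bar>g n\<bar>"
        by (intro mult_right_mono) (auto intro: order_trans[OF le_of_int_ceiling abs_ge_self])
      also have "\<dots> < 1" using elim by (simp add: abs_mult)
      finally show False by simp
    qed
  qed
  then show ?thesis by (simp add: g ultrapower_simps germ_eq_iff)
qed


section \<open>Ideals of polynomials with infinitesimal value\<close>

text \<open>Zero is infinitesimal, so every polynomial that vanishes at \<open>\<theta>\<close> is in the domain of the error
  map. Its kernel is thus the kernel of a ring homomorphism, and hence an ideal, although the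
  domain itself is only an additive group.\<close>

lemma error_kernel_eq:
  "error_kernel U \<theta> = a_kernel (hyperint_polys U) (ultrapower U) (hyper_eval U \<theta>)"
proof -
  have "F \<in> error_kernel U \<theta> \<longleftrightarrow> F \<in> dioph_polys U \<theta> \<and> hyper_eval U \<theta> F = \<zero>\<^bsub>ultrapower U\<^esub>" for F
    by (simp add: error_kernel_def a_kernel_def' error_map_def cong: conj_cong)
  moreover have "F \<in> a_kernel (hyperint_polys U) (ultrapower U) (hyper_eval U \<theta>) \<longleftrightarrow>
      F \<in> carrier (hyperint_polys U) \<and> hyper_eval U \<theta> F = \<zero>\<^bsub>ultrapower U\<^esub>" for F
    by (simp add: a_kernel_def')
  moreover have "F \<in> dioph_polys U \<theta> \<longleftrightarrow>
      F \<in> carrier (hyperint_polys U) \<and> hyper_eval U \<theta> F \<in> infinitesimals U" for F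
    by (simp add: dioph_polys_def)
  ultimately show ?thesis
    using zero_infinitesimal[of U] by (metis (no_types, lifting) subsetI subset_antisym)
qed

lemma mem_error_kernel_iff:
  "F \<in> error_kernel U \<theta> \<longleftrightarrow>
    F \<in> carrier (hyperint_polys U) \<and> hyper_eval U \<theta> F = \<zero>\<^bsub>ultrapower U\<^esub>"
  by (simp only: error_kernel_eq a_kernel_def' mem_Collect_eq)

lemma ideal_error_kernel: "ideal (error_kernel U \<theta>) (hyperint_polys U)"
  unfolding error_kernel_eq by (rule ring_hom_ring.kernel_is_ideal[OF hyper_eval_ring_hom])

lemma error_kernel_subset: "error_kernel U \<theta> \<subseteq> dioph_polys U \<theta>"
proof
  fix F assume "F \<in> error_kernel U \<theta>"
  then show "F \<in> dioph_polys U \<theta>"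
    using zero_infinitesimal[of U] by (simp add: mem_error_kernel_iff dioph_polys_def)
qed

text \<open>The ideal contains all multiples of \<open>F\<close> by constant polynomials, so all hyperinteger multiples
  of the value \<open>F(\<theta>)\<close> are infinitesimal.\<close>

lemma ideal_subset_error_kernel:
  assumes J: "ideal J (hyperint_polys U)" and sub: "J \<subseteq> dioph_polys U \<theta>"
  shows "J \<subseteq> error_kernel U \<theta>"
proof
  fix F assume F: "F \<in> J"
  interpret ev: ring_hom_ring "hyperint_polys U" "ultrapower U" "hyper_eval U \<theta>"
    by (rule hyper_eval_ring_hom)
  have Fc: "F \<in> carrier (hyperint_polys U)" using F sub by (auto simp: dioph_polys_def)
  have "hyper_eval U \<theta> F = \<zero>\<^bsub>ultrapower U\<^esub>"
  proof (rule infinitesimal_multiples_imp_zero)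
    fix N :: "(nat \<Rightarrow> int) set" assume N: "N \<in> carrier (ultrapower U)"
    let ?N = "const_mpoly (ultrapower U) N"
    have Nc: "?N \<in> carrier (hyperint_polys U)"
      unfolding hyperint_polys_def by (rule const_mpoly_closed[OF cring_ultrapower N])
    have "hyper_eval U \<theta> ?N = hyperreal_of_hyperint U N"
      unfolding hyper_eval_def
      by (rule ring_hom_cring.mpoly_eval_const[OF hyperreal_of_hyperint_hom N])
        (simp add: hyperreal_of_real_def ultrapower_simps)
    moreover have "?N \<otimes>\<^bsub>hyperint_polys U\<^esub> F \<in> dioph_polys U \<theta>"
      using ideal.I_l_closed[OF J F Nc] sub by blast
    ultimately show "hyperreal_of_hyperint U N \<otimes>\<^bsub>ultrapower U\<^esub> hyper_eval U \<theta> F \<in> infinitesimals U"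
      using ev.hom_mult[OF Nc Fc] by (simp add: dioph_polys_def)
  qed (simp add: Fc)
  with Fc show "F \<in> error_kernel U \<theta>" by (simp only: mem_error_kernel_iff simp_thms)
qed


section \<open>Algebraic dependence and the kernel\<close>

lemma type_algebra_simps:
  "carrier (ring_of_type_algebra :: 'a::comm_ring_1 ring) = UNIV"
  "\<zero>\<^bsub>ring_of_type_algebra\<^esub> = (0 :: 'a)"
  "\<one>\<^bsub>ring_of_type_algebra\<^esub> = (1 :: 'a)"
  "a \<oplus>\<^bsub>ring_of_type_algebra\<^esub> b = (a + b :: 'a)"
  "a \<otimes>\<^bsub>ring_of_type_algebra\<^esub> b = (a * b :: 'a)"
  by (simp_all add: ring_of_type_algebra_def)

lemma finsum_finprod_type_algebra:
  fixes f :: "'b \<Rightarrow> 'a::comm_ring_1"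
  assumes "finite A"
  shows "finsum ring_of_type_algebra f A = (\<Sum>a\<in>A. f a)"
    and "finprod ring_of_type_algebra f A = (\<Prod>a\<in>A. f a)"
proof -
  interpret cring "ring_of_type_algebra :: 'a ring" by (rule cring_from_type_algebra)
  show "finsum ring_of_type_algebra f A = (\<Sum>a\<in>A. f a)"
    using assms by induction (simp_all add: type_algebra_simps)
  show "finprod ring_of_type_algebra f A = (\<Prod>a\<in>A. f a)"
    using assms by induction (simp_all add: type_algebra_simps)
qed

lemma power_type_algebra: "(a :: 'a::comm_ring_1) [^]\<^bsub>ring_of_type_algebra\<^esub> (k :: nat) = a ^ k"
proof -
  interpret cring "ring_of_type_algebra :: 'a ring" by (rule cring_from_type_algebra)
  show ?thesis by (induction k) (simp_all add: type_algebra_simps mult.commute)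
qed

lemma algebraically_dependent_iff_rat:
  "algebraically_dependent_over_rat \<theta> \<longleftrightarrow>
    (\<exists>p :: 'n multiset \<Rightarrow> rat. finite {m. p m \<noteq> 0} \<and> (\<exists>m. p m \<noteq> 0) \<and>
      (\<Sum>m | p m \<noteq> 0. of_rat (p m) * monomial_at \<theta> m) = 0)"
  for \<theta> :: "real ^ 'n"
proof -
  have eval: "mpoly_eval ring_of_type_algebra ring_of_type_algebra of_rat (\<lambda>i. \<theta> $ i) p =
      (\<Sum>m | p m \<noteq> 0. of_rat (p m) * monomial_at \<theta> m)"
    if "finite {m. p m \<noteq> 0}" for p :: "'n multiset \<Rightarrow> rat"
    using that by (simp add: mpoly_eval_def
      finsum_finprod_type_algebra power_type_algebra type_algebra_simps)
  have "p \<in> carrier (mpoly_ring ring_of_type_algebra) \<and>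
        p \<noteq> \<zero>\<^bsub>mpoly_ring (ring_of_type_algebra :: rat ring)\<^esub> \<and>
        mpoly_eval ring_of_type_algebra ring_of_type_algebra of_rat (\<lambda>i. \<theta> $ i) p = 0 \<longleftrightarrow>
      finite {m. p m \<noteq> 0} \<and> (\<exists>m. p m \<noteq> 0) \<and>
        (\<Sum>m | p m \<noteq> 0. of_rat (p m) * monomial_at \<theta> m) = 0"
    for p :: "'n multiset \<Rightarrow> rat"
    using eval[of p] by (auto simp: mpoly_ring_simps type_algebra_simps fun_eq_iff)
  then show ?thesis
    by (simp only: algebraically_dependent_over_rat_def Bex_def)
qed

text \<open>Clearing denominators replaces a rational relation by an integral one. The finite set \<open>A\<close>
  of monomials may be larger than the support: it serves as a common bound for the supports of
  all members of a sequence of integer polynomials.\<close>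

lemma algebraically_dependent_iff_int:
  "algebraically_dependent_over_rat \<theta> \<longleftrightarrow>
    (\<exists>A (c :: 'n multiset \<Rightarrow> int). finite A \<and> (\<exists>m\<in>A. c m \<noteq> 0) \<and>
      (\<Sum>m\<in>A. of_int (c m) * monomial_at \<theta> m) = 0)"
  for \<theta> :: "real ^ 'n"
proof
  assume "algebraically_dependent_over_rat \<theta>"
  then obtain p :: "'n multiset \<Rightarrow> rat" and m0 where fin: "finite {m. p m \<noteq> 0}" and m0: "p m0 \<noteq> 0"
    and sum: "(\<Sum>m | p m \<noteq> 0. of_rat (p m) * monomial_at \<theta> m) = 0"
    unfolding algebraically_dependent_iff_rat by blast
  let ?A = "{m. p m \<noteq> 0}"
  define d where "d = (\<Prod>m\<in>?A. snd (quotient_of (p m)))"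
  have d: "d > 0" unfolding d_def by (intro prod_pos) (simp add: quotient_of_denom_pos')
  have "\<exists>z. rat_of_int d * p m = of_int z" if "m \<in> ?A" for m
  proof -
    let ?q = "quotient_of (p m)"
    have "snd ?q dvd d" unfolding d_def using fin that by (intro dvd_prodI) auto
    then obtain e where e: "d = snd ?q * e" ..
    have "p m = of_int (fst ?q) / of_int (snd ?q)"
      by (rule quotient_of_div) simp
    then have "rat_of_int d * p m = of_int (e * fst ?q)"
      using quotient_of_denom_pos'[of "p m"] by (simp add: e field_simps)
    then show ?thesis ..
  qed
  then obtain c where c: "\<And>m. m \<in> ?A \<Longrightarrow> rat_of_int d * p m = of_int (c m)" by metis
  have c': "real_of_int (c m) = of_int d * of_rat (p m)" if "m \<in> ?A" for m
    using arg_cong[OF c[OF that], of "of_rat :: rat \<Rightarrow> real"] by (simp add: of_rat_mult)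
  have "(\<Sum>m\<in>?A. of_int (c m) * monomial_at \<theta> m) = of_int d * (\<Sum>m\<in>?A. of_rat (p m) * monomial_at \<theta> m)"
    by (simp add: c' sum_distrib_left mult.assoc)
  then have "(\<Sum>m\<in>?A. of_int (c m) * monomial_at \<theta> m) = 0" using sum by simp
  moreover have "c m0 \<noteq> 0" using c'[of m0] m0 d by auto
  ultimately show "\<exists>A (c :: 'n multiset \<Rightarrow> int). finite A \<and> (\<exists>m\<in>A. c m \<noteq> 0) \<and>
      (\<Sum>m\<in>A. of_int (c m) * monomial_at \<theta> m) = 0"
    using fin m0 by blast
next
  assume "\<exists>A (c :: 'n multiset \<Rightarrow> int). finite A \<and> (\<exists>m\<in>A. c m \<noteq> 0) \<and>
      (\<Sum>m\<in>A. of_int (c m) * monomial_at \<theta> m) = 0"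
  then obtain A m0 and c :: "'n multiset \<Rightarrow> int" where A: "finite A" "m0 \<in> A" "c m0 \<noteq> 0"
    and sum: "(\<Sum>m\<in>A. of_int (c m) * monomial_at \<theta> m) = 0"
    by blast
  define p where "p m = (if m \<in> A then rat_of_int (c m) else 0)" for m
  have supp: "{m. p m \<noteq> 0} \<subseteq> A" by (auto simp: p_def split: if_splits)
  have "(\<Sum>m | p m \<noteq> 0. of_rat (p m) * monomial_at \<theta> m) = (\<Sum>m\<in>A. of_int (c m) * monomial_at \<theta> m)"
    by (rule sum.mono_neutral_cong_left) (use A supp in \<open>auto simp: p_def\<close>)
  moreover have "p m0 \<noteq> 0" using A by (simp add: p_def)
  moreover have "finite {m. p m \<noteq> 0}" using supp A finite_subset by blast
  ultimately show "algebraically_dependent_over_rat \<theta>"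
    unfolding algebraically_dependent_iff_rat using sum by auto
qed

text \<open>From left to right, the coefficients of an integral relation become constant sequences; their
  germs are nonzero because the filter is proper. From right to left, the relation obtained from
  representatives holds at almost all indices, while a nonzero coefficient is represented by a
  sequence that does not vanish almost everywhere; an index where both happen gives the integral
  relation.\<close>

lemma algebraically_dependent_iff_error_kernel_nonzero:
  fixes \<theta> :: "real ^ 'n"
  assumes U: "U \<noteq> bot"
  shows "algebraically_dependent_over_rat \<theta> \<longleftrightarrow> error_kernel U \<theta> \<noteq> {\<zero>\<^bsub>hyperint_polys U\<^esub>}"
proof
  assume "algebraically_dependent_over_rat \<theta>"
  then obtain A m0 and c :: "'n multiset \<Rightarrow> int" where A: "finite A" "m0 \<in> A" "c m0 \<noteq> 0"
    and sum: "(\<Sum>m\<in>A. of_int (c m) * monomial_at \<theta> m) = 0"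
    unfolding algebraically_dependent_iff_int by blast
  define f where "f m = (\<lambda>n::nat. if m \<in> A then c m else 0)" for m
  define F where "F m = germ U (f m)" for m
  have supp: "{m. F m \<noteq> germ U (\<lambda>_. 0)} \<subseteq> A" by (auto simp: F_def f_def)
  then have F: "F \<in> carrier (hyperint_polys U)"
    using A(1) by (auto simp: hyperint_polys_def mpoly_ring_simps ultrapower_simps F_def
        intro: finite_subset)
  have "hyper_eval U \<theta> F = germ U (\<lambda>n. \<Sum>m\<in>A. real_of_int (f m n) * monomial_at \<theta> m)"
    using hyper_eval_germ[of U f A] F A(1) supp unfolding F_def by blast
  also have "\<dots> = \<zero>\<^bsub>ultrapower U\<^esub>"
    using sum by (simp add: f_def ultrapower_simps)
  finally have "F \<in> error_kernel U \<theta>" using F by (simp add: mem_error_kernel_iff)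
  moreover have "F m0 \<noteq> germ U (\<lambda>_. 0)"
    using A U by (simp add: F_def f_def germ_eq_iff)
  then have "F \<noteq> \<zero>\<^bsub>hyperint_polys U\<^esub>"
    by (auto simp: hyperint_polys_def mpoly_ring_simps ultrapower_simps)
  ultimately show "error_kernel U \<theta> \<noteq> {\<zero>\<^bsub>hyperint_polys U\<^esub>}" by blast
next
  assume "error_kernel U \<theta> \<noteq> {\<zero>\<^bsub>hyperint_polys U\<^esub>}"
  moreover have "\<zero>\<^bsub>hyperint_polys U\<^esub> \<in> error_kernel U \<theta>"
    by (rule additive_subgroup.zero_closed[OF ideal.axioms(1)[OF ideal_error_kernel]])
  ultimately obtain F where "F \<in> error_kernel U \<theta>" "F \<noteq> \<zero>\<^bsub>hyperint_polys U\<^esub>"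
    by blast
  then have F: "F \<in> carrier (hyperint_polys U)" "F \<noteq> \<zero>\<^bsub>hyperint_polys U\<^esub>"
    and ev: "hyper_eval U \<theta> F = \<zero>\<^bsub>ultrapower U\<^esub>"
    unfolding mem_error_kernel_iff by blast+
  from F(1) obtain f where f: "F = (\<lambda>m. germ U (f m))"
    and fin: "finite {m. germ U (f m) \<noteq> germ U (\<lambda>_. 0)}"
    by (rule hyperint_poly_representatives)
  let ?A = "{m. germ U (f m) \<noteq> germ U (\<lambda>_. 0)}"
  have "eventually (\<lambda>n. (\<Sum>m\<in>?A. real_of_int (f m n) * monomial_at \<theta> m) = 0) U"
    using hyper_eval_germ[OF F(1)[unfolded f] fin order_refl, of \<theta>] ev
    by (simp add: f ultrapower_simps germ_eq_iff)
  moreover from F(2) obtain m0 where m0: "m0 \<in> ?A"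
    by (auto simp: f hyperint_polys_def mpoly_ring_simps ultrapower_simps fun_eq_iff)
  then have "\<exists>\<^sub>F n in U. f m0 n \<noteq> 0" by (simp add: germ_eq_iff frequently_def)
  ultimately have "\<exists>\<^sub>F n in U. (\<Sum>m\<in>?A. real_of_int (f m n) * monomial_at \<theta> m) = 0 \<and> f m0 n \<noteq> 0"
    by (intro frequently_eventually_conj)
  then obtain n where "f m0 n \<noteq> 0" "(\<Sum>m\<in>?A. real_of_int (f m n) * monomial_at \<theta> m) = 0"
    by (auto dest: frequently_ex)
  with m0 fin show "algebraically_dependent_over_rat \<theta>"
    unfolding algebraically_dependent_iff_int by (intro exI[of _ ?A] exI[of _ "\<lambda>m. f m n"]) blast
qed

theorem theorem18:
  fixes U :: "nat filter" and \<theta> :: "real ^ 'n"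
  assumes "nonprincipal_ultrafilter U"
  shows "(algebraically_dependent_over_rat \<theta> \<longleftrightarrow>
            (\<exists>I. I \<in> nonzero_ideals_within (hyperint_polys U) (dioph_polys U \<theta>))) \<and>
         ((\<exists>I. I \<in> nonzero_ideals_within (hyperint_polys U) (dioph_polys U \<theta>)) \<longrightarrow>
            error_kernel U \<theta> \<in> nonzero_ideals_within (hyperint_polys U) (dioph_polys U \<theta>) \<and>
            (\<forall>J \<in> nonzero_ideals_within (hyperint_polys U) (dioph_polys U \<theta>). J \<subseteq> error_kernel U \<theta>))"
proof -
  let ?Z = "{\<zero>\<^bsub>hyperint_polys U\<^esub>}"
  let ?N = "nonzero_ideals_within (hyperint_polys U) (dioph_polys U \<theta>)"
  have max: "J \<subseteq> error_kernel U \<theta>" if "J \<in> ?N" for J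
    using that ideal_subset_error_kernel by (auto simp: nonzero_ideals_within_def)
  have mem: "error_kernel U \<theta> \<in> ?N \<longleftrightarrow> error_kernel U \<theta> \<noteq> ?Z"
    by (simp add: nonzero_ideals_within_def ideal_error_kernel error_kernel_subset)
  have nonzero: "error_kernel U \<theta> \<noteq> ?Z" if J: "J \<in> ?N" for J
  proof
    assume "error_kernel U \<theta> = ?Z"
    then have "J \<subseteq> ?Z" using max[OF J] by simp
    moreover have "ideal J (hyperint_polys U)" "J \<noteq> ?Z"
      using J by (auto simp: nonzero_ideals_within_def)
    moreover from this have "\<zero>\<^bsub>hyperint_polys U\<^esub> \<in> J"
      by (auto intro: additive_subgroup.zero_closed ideal.axioms(1))
    ultimately show False by blast
  qed
  have "U \<noteq> bot" using assms by (simp add: nonprincipal_ultrafilter_def)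
  then have "algebraically_dependent_over_rat \<theta> \<longleftrightarrow> error_kernel U \<theta> \<noteq> ?Z"
    by (rule algebraically_dependent_iff_error_kernel_nonzero)
  then show ?thesis using max mem nonzero by blast
qed

end
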